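(* Let $S,K\subset\mathbb{R}$ be nonempty open bounded intervals and let $h>0$. The operator $b_2:L^2(S,\mathbb{R}^2)\to L^2(K)$, $b_2[(m_1,m_2)]=-\left[\partial_y\left(Q_y\star\widetilde{m_1}+P_y\star\widetilde{m_2}\right)\right]_{|K,\;y=h}$, is injective.
   Context: For a bounded interval $I$ and $f\in L^2(I)$ (real-valued), $\widetilde f\in L^2(\mathbb{R})$ denotes the extension of $f$ by $0$ outside $I$. For $y>0$, $x\in\mathbb{R}$, $P_y(x)=\frac{1}{\pi}\frac{y}{x^2+y^2}$ is the Poisson kernel and $Q_y(x)=\frac{1}{\pi}\frac{x}{x^2+y^2}$ the conjugate Poisson kernel of the upper half-plane; $\star$ is convolution in the variable $x\in\mathbb{R}$. By the Cauchy-Riemann equations, equivalently $b_2[(m_1,m_2)]=-\left[\partial_x\left(P_h\star\widetilde{m_1}-Q_h\star\widetilde{m_2}\right)\right]_{|K}$. The operator $b_2$ is bounded. *)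

theory Defs
  imports "HOL-Analysis.Analysis"
begin

definition L2_fun :: "real set \<Rightarrow> (real \<Rightarrow> 'a::euclidean_space) set" where
  "L2_fun I = {f. f \<in> borel_measurable (lebesgue_on I) \<and>
                  integrable (lebesgue_on I) (\<lambda>x. (norm (f x))\<^sup>2)}"

definition ae_eq :: "real set \<Rightarrow> (real \<Rightarrow> 'a::euclidean_space) rel" where
  "ae_eq I = {(f, g). f \<in> L2_fun I \<and> g \<in> L2_fun I \<and> (AE x in lebesgue_on I. f x = g x)}"

text \<open>
  The elements of \<open>L2 I\<close> are classes of total functions; the values outside \<open>I\<close> are
  irrelevant, since both square integrability and almost-everywhere equality refer to
  Lebesgue measure restricted to \<open>I\<close>.
\<close>

definition L2 :: "real set \<Rightarrow> (real \<Rightarrow> 'a::euclidean_space) set set" where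
  "L2 I = L2_fun I // ae_eq I"

lemma equiv_ae_eq: "equiv (L2_fun I) (ae_eq I)"
proof (rule equivI)
  show "ae_eq I \<subseteq> L2_fun I \<times> L2_fun I" "refl_on (L2_fun I) (ae_eq I)"
    by (auto simp: ae_eq_def refl_on_def)
  show "sym (ae_eq I)"
    by (auto simp: ae_eq_def sym_def eq_commute)
  show "trans (ae_eq I)"
    by (rule transI) (auto simp: ae_eq_def)
qed

definition zero_ext :: "real set \<Rightarrow> (real \<Rightarrow> real) \<Rightarrow> real \<Rightarrow> real" where
  "zero_ext I f = (\<lambda>x. if x \<in> I then f x else 0)"

definition poisson_kernel :: "real \<Rightarrow> real \<Rightarrow> real" where
  "poisson_kernel y x = 1 / pi * (y / (x\<^sup>2 + y\<^sup>2))"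

definition conj_poisson_kernel :: "real \<Rightarrow> real \<Rightarrow> real" where
  "conj_poisson_kernel y x = 1 / pi * (x / (x\<^sup>2 + y\<^sup>2))"

text \<open>
  The integral is taken over \<open>lebesgue\<close> rather than \<open>lborel\<close>: representatives are only
  Lebesgue measurable, and the \<open>lborel\<close> integral of a non-Borel function is 0 by convention.
\<close>

definition conv :: "(real \<Rightarrow> real) \<Rightarrow> (real \<Rightarrow> real) \<Rightarrow> real \<Rightarrow> real" where
  "conv f g x = (LINT t|lebesgue. f (x - t) * g t)"

definition b2_fun :: "real set \<Rightarrow> real \<Rightarrow> (real \<Rightarrow> real \<times> real) \<Rightarrow> real \<Rightarrow> real" where
  "b2_fun S h m x =
     - deriv (\<lambda>y. conv (conj_poisson_kernel y) (zero_ext S (\<lambda>t. fst (m t))) x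
                + conv (poisson_kernel y) (zero_ext S (\<lambda>t. snd (m t))) x) h"

text \<open>
  \<open>b2_fun\<close> lifted to classes, as a union over all representatives of the argument.
  Restriction to \<open>K\<close> consists in passing to the class modulo equality almost everywhere
  on \<open>K\<close>. If the value did not lie in \<open>L2_fun K\<close>, its relational image would be empty, and
  the empty set is not an element of \<open>L2 K\<close>.
\<close>

definition b2 :: "real set \<Rightarrow> real set \<Rightarrow> real \<Rightarrow> (real \<Rightarrow> real \<times> real) set \<Rightarrow> (real \<Rightarrow> real) set"
  where "b2 S K h M = (\<Union>m\<in>M. ae_eq K `` {b2_fun S h m})"

end

theory Submission
  imports Defs "HOL-Complex_Analysis.Complex_Analysis"
begin

text \<open>
  Write \<open>f = m\<^sub>1 + i m\<^sub>2\<close>, extended by zero, and \<open>z = x + iy\<close>. Then \<open>Q\<^sub>y \<star> m\<^sub>1 + P\<^sub>y \<star> m\<^sub>2\<close> is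
  \<open>1/\<pi>\<close> times the real part of the Cauchy transform \<open>\<integral> f(t) / (z - t) dt\<close>, so that
  \<open>b\<^sub>2[m](x) = - Im A(x + ih) / \<pi>\<close> with \<open>A(z) = \<integral> f(t) / (z - t)\<^sup>2 dt\<close>. Let \<open>B\<close> be the same
  integral for the conjugate of \<open>f\<close>. If \<open>b\<^sub>2[m]\<close> vanishes on \<open>K\<close>, then
  \<open>A(z) = cnj (A(z)) = B(cnj z) = B(z - 2ih)\<close> for \<open>z \<in> K + ih\<close>, hence on the whole strip
  \<open>0 < Im z < 2h\<close>. As \<open>A\<close> is holomorphic for \<open>Im z > 0\<close> and \<open>B(z - 2ih)\<close> for \<open>Im z < 2h\<close>, they
  glue to a bounded entire function, which is constant by Liouville's theorem and tends to 0
  along the imaginary axis. So \<open>A\<close> vanishes on the upper half-plane, and off the compact segment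
  carrying \<open>f\<close>, whose complement is connected. The expansion of \<open>A\<close> at infinity then shows that all
  moments of \<open>f\<close> vanish, and \<open>f = 0\<close> almost everywhere by the Weierstrass approximation theorem.
\<close>

section \<open>Integrable functions with vanishing moments\<close>

text \<open>Domination by \<open>B * cmod (f t)\<close>. The bound on \<open>g\<close> is asked only
  where \<open>f\<close> is nonzero, so that globally unbounded factors such as powers of
  \<open>t\<close> or the Cauchy kernel qualify.\<close>

lemma integrable_mult_bounded_on_support:
  fixes f g :: "'a \<Rightarrow> complex"
  assumes f: "integrable M f" and g: "g \<in> borel_measurable M"
    and B: "\<And>t. f t \<noteq> 0 \<Longrightarrow> cmod (g t) \<le> B"
  shows "integrable M (\<lambda>t. g t * f t)"
    and "cmod (LINT t|M. g t * f t) \<le> B * (LINT t|M. cmod (f t))"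
proof -
  have le: "cmod (g t * f t) \<le> B * cmod (f t)" for t
    by (cases "f t = 0") (auto simp: norm_mult intro!: mult_right_mono B)
  have int: "integrable M (\<lambda>t. B * cmod (f t))"
    using f by auto
  show 1: "integrable M (\<lambda>t. g t * f t)"
  proof (rule Bochner_Integration.integrable_bound[OF int])
    show "(\<lambda>t. g t * f t) \<in> borel_measurable M"
      using f g by auto
    show "AE t in M. cmod (g t * f t) \<le> norm (B * cmod (f t))"
      using le by (smt (verit) AE_I2 real_norm_def)
  qed
  have "cmod (LINT t|M. g t * f t) \<le> (LINT t|M. cmod (g t * f t))"
    by simp
  also have "\<dots> \<le> (LINT t|M. B * cmod (f t))"
    using 1 int le by (intro integral_mono) auto
  finally show "cmod (LINT t|M. g t * f t) \<le> B * (LINT t|M. cmod (f t))"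
    by simp
qed

section \<open>Functions determined by their integrals over closed sets\<close>

lemma sigma_finite_lebesgue: "sigma_finite_measure (lebesgue :: real measure)"
proof
  obtain A :: "real set set" where "countable A" "A \<subseteq> sets lborel" "\<Union>A = space lborel"
    "\<forall>a\<in>A. emeasure lborel a \<noteq> \<infinity>"
    using lborel.sigma_finite_countable by blast
  then show "\<exists>A. countable A \<and> A \<subseteq> sets lebesgue \<and> \<Union>A = space lebesgue
      \<and> (\<forall>a\<in>A. emeasure (lebesgue :: real measure) a \<noteq> \<infinity>)"
    by (intro exI[of _ A]) auto
qed

text \<open>Closed sets form an intersection-stable generator of the Borel sets, so Dynkin's
  argument gives zero integrals over all Borel sets. Null sets extend this to all Lebesgue sets, and
  \<open>density_zero\<close> concludes.\<close>

lemma AE_zero_if_closed_integrals_zero: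
  fixes f :: "real \<Rightarrow> complex"
  assumes f: "integrable lebesgue f"
    and zero: "\<And>C. closed C \<Longrightarrow> set_lebesgue_integral lebesgue C f = 0"
  shows "AE t in lebesgue. f t = 0"
proof -
  interpret sigma_finite_measure "lebesgue :: real measure"
    by (rule sigma_finite_lebesgue)
  have si: "set_integrable lebesgue A f" if "A \<in> sets lebesgue" for A
    using f that unfolding set_integrable_def by (rule integrable_mult_indicator[rotated])
  have borel: "set_lebesgue_integral lebesgue A f = 0" if "A \<in> sets borel" for A
  proof -
    have sets: "sigma_sets UNIV (Collect closed) = sets (borel :: real measure)"
      by (simp add: borel_eq_closed)
    have "Int_stable (Collect closed :: real set set)" "(Collect closed :: real set set) \<subseteq> Pow UNIV"
      "A \<in> sigma_sets UNIV (Collect closed)"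
      using that by (auto simp: Int_stable_def sets)
    then show ?thesis
    proof (induction rule: sigma_sets_induct_disjoint)
      case (basic A)
      then show ?case using zero by simp
    next
      case empty
      then show ?case by (simp add: set_lebesgue_integral_def)
    next
      case (compl A)
      then have A: "A \<in> sets lebesgue"
        by (simp add: sets)
      \<comment> \<open>\<open>UNIV\<close> is closed, so the total integral is 0 and the complement
        inherits the value 0 from \<open>A\<close>.\<close>
      have "set_lebesgue_integral lebesgue (A \<union> (UNIV - A)) f
          = set_lebesgue_integral lebesgue A f + set_lebesgue_integral lebesgue (UNIV - A) f"
        using A by (intro set_integral_Un si) auto
      then show ?case
        using compl zero[of UNIV] by simp
    next
      case (union A)
      then have A: "A i \<in> sets lebesgue" for i
        by (auto simp: sets)
      have "set_lebesgue_integral lebesgue (\<Union>i. A i) f = (\<Sum>i. set_lebesgue_integral lebesgue (A i) f)"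
      proof (rule lebesgue_integral_countable_add)
        show "A i \<inter> A j = {}" if "i \<noteq> j" for i j
          using union that by (auto simp: disjoint_family_on_def)
        show "set_integrable lebesgue (\<Union>i. A i) f"
          using A by (intro si) auto
      qed (use A in auto)
      then show ?case using union by simp
    qed
  qed
  have "set_lebesgue_integral lebesgue A f = 0" if "A \<in> sets lebesgue" for A
  proof -
    \<comment> \<open>A Lebesgue set is a Borel set up to a part \<open>N\<close> of a Borel null
      set; \<open>N\<close> itself may fail to be Borel, so the exceptional set used below is
      \<open>N'\<close>.\<close>
    obtain B N N' where A: "A = B \<union> N" "N \<subseteq> N'" "N' \<in> null_sets lborel" "B \<in> sets lborel"
      using sets_completionE[OF \<open>A \<in> sets lebesgue\<close>] by metis
    then have B: "B \<in> sets lebesgue"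
      by simp
    have N': "AE t in lebesgue. t \<notin> N'"
      using A(3) by (intro AE_not_in null_sets_completionI)
    have "set_lebesgue_integral lebesgue A f = set_lebesgue_integral lebesgue B f"
      unfolding set_lebesgue_integral_def
    proof (rule integral_cong_AE)
      show "AE t in lebesgue. indicat_real A t *\<^sub>R f t = indicat_real B t *\<^sub>R f t"
        using N' by eventually_elim (use A in \<open>auto simp: indicator_def\<close>)
    qed (use si[OF that] si[OF B] in \<open>auto simp: set_integrable_def\<close>)
    then show ?thesis using borel A by simp
  qed
  with f show ?thesis by (rule density_zero)
qed

lemma lebesgue_measurable_if_continuous:
  fixes g :: "real \<Rightarrow> 'b::euclidean_space"
  assumes "continuous_on UNIV g"
  shows "g \<in> borel_measurable lebesgue"
  using continuous_imp_measurable_on_sets_lebesgue[OF assms] by simp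

text \<open>Weierstrass approximation on \<open>{a..b}\<close> passes from powers of
  \<open>t\<close> to continuous test functions; continuous cutoffs then pass to indicators of
  closed sets.\<close>

lemma AE_zero_if_moments_zero:
  fixes f :: "real \<Rightarrow> complex"
  assumes f: "integrable lebesgue f" and supp: "\<And>t. t \<notin> {a..b} \<Longrightarrow> f t = 0"
    and moments: "\<And>n. (LINT t|lebesgue. of_real t ^ n * f t) = 0"
  shows "AE t in lebesgue. f t = 0"
proof (rule AE_zero_if_closed_integrals_zero[OF f])
  have cont: "(LINT t|lebesgue. of_real (\<phi> t) * f t) = 0"
    if \<phi>: "continuous_on UNIV \<phi>" for \<phi> :: "real \<Rightarrow> real"
  proof -
    let ?N = "LINT t|lebesgue. cmod (f t)"
    have le: "cmod (LINT t|lebesgue. of_real (\<phi> t) * f t) \<le> e * ?N" if "e > 0" for e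
    proof -
      obtain p where p: "real_polynomial_function p" "\<And>t. t \<in> {a..b} \<Longrightarrow> \<bar>\<phi> t - p t\<bar> < e"
        using Stone_Weierstrass_real_polynomial_function[of "{a..b}" \<phi> e] \<phi> \<open>e > 0\<close>
        by (metis compact_Icc continuous_on_subset subset_UNIV)
      then obtain c n where c: "p = (\<lambda>t. \<Sum>i\<le>n. c i * t ^ i)"
        using real_polynomial_function_iff_sum by auto
      have int: "integrable lebesgue (\<lambda>t. of_real t ^ i * f t)" for i
      proof (rule integrable_mult_bounded_on_support(1)[OF f])
        show "cmod (of_real t ^ i) \<le> (\<bar>a\<bar> + \<bar>b\<bar>) ^ i" if "f t \<noteq> 0" for t
        proof -
          have "t \<in> {a..b}"
            using supp that by blast
          then show ?thesis
            by (auto simp: norm_power intro!: power_mono)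
        qed
      qed (auto intro!: lebesgue_measurable_if_continuous continuous_intros)
      have eq: "of_real (p t) * f t = (\<Sum>i\<le>n. of_real (c i) * (of_real t ^ i * f t))" for t
        by (simp add: c sum_distrib_right mult.assoc)
      have p0: "(LINT t|lebesgue. of_real (p t) * f t) = 0"
        using int moments by (simp add: eq)
      have pint: "integrable lebesgue (\<lambda>t. of_real (p t) * f t)"
        using int by (simp add: eq)
      have bd: "cmod (of_real (\<phi> t - p t)) \<le> e" if "f t \<noteq> 0" for t
        unfolding norm_of_real using p(2)[of t] supp[of t] that by fastforce
      have m: "(\<lambda>t. complex_of_real (\<phi> t - p t)) \<in> borel_measurable lebesgue"
        unfolding c by (intro lebesgue_measurable_if_continuous continuous_intros \<phi>)
      note * = integrable_mult_bounded_on_support[OF f m bd]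
      have "(LINT t|lebesgue. of_real (\<phi> t) * f t)
          = (LINT t|lebesgue. of_real (\<phi> t - p t) * f t + of_real (p t) * f t)"
        by (simp add: algebra_simps)
      also have "\<dots> = (LINT t|lebesgue. of_real (\<phi> t - p t) * f t)"
        using *(1) pint p0 by (subst Bochner_Integration.integral_add) auto
      finally show ?thesis using *(2) by simp
    qed
    have "cmod (LINT t|lebesgue. of_real (\<phi> t) * f t) \<le> 0 * ?N"
    proof (rule tendsto_lowerbound)
      show "((\<lambda>e. e * ?N) \<longlongrightarrow> 0 * ?N) (at_right 0)"
        by (intro tendsto_intros)
      show "\<forall>\<^sub>F e in at_right 0. cmod (LINT t|lebesgue. of_real (\<phi> t) * f t) \<le> e * ?N"
        by (auto simp: eventually_at_right_field intro!: exI[of _ 1] le)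
    qed simp
    then show ?thesis by simp
  qed
  fix C :: "real set"
  assume C: "closed C"
  show "set_lebesgue_integral lebesgue C f = 0"
  \<comment> \<open>By convention \<open>infdist t {} = 0\<close>, which would make the cutoffs
    below identically 1; the empty set is therefore treated apart.\<close>
  proof (cases "C = {}")
    case True
    then show ?thesis by (simp add: set_lebesgue_integral_def)
  next
    case False
    \<comment> \<open>These continuous cutoffs equal 1 on \<open>C\<close> and, for
      \<open>n > 0\<close>, vanish at distance at least \<open>1 / n\<close> from
      \<open>C\<close>.\<close>
    define \<phi> where "\<phi> n t = max 0 (1 - real n * infdist t C)" for n t
    have \<phi>c: "continuous_on UNIV (\<phi> n)" for n
      unfolding \<phi>_def by (intro continuous_intros)
    have lim: "(\<lambda>n. \<phi> n t) \<longlonglongrightarrow> indicator C t" for t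
    proof (cases "t \<in> C")
      case True
      then show ?thesis by (simp add: \<phi>_def)
    next
      case out: False
      have d: "infdist t C > 0"
        using infdist_pos_not_in_closed[OF C False out] .
      have "\<forall>\<^sub>F n in sequentially. \<phi> n t = 0"
        using eventually_ge_at_top[of "nat \<lceil>1 / infdist t C\<rceil>"]
      proof eventually_elim
        case (elim n)
        then have "1 / infdist t C \<le> real n" by linarith
        then show ?case using d by (simp add: \<phi>_def field_simps)
      qed
      then show ?thesis using out by (simp add: tendsto_eventually)
    qed
    have "(\<lambda>n. LINT t|lebesgue. of_real (\<phi> n t) * f t) \<longlonglongrightarrow> set_lebesgue_integral lebesgue C f"
      unfolding set_lebesgue_integral_def
    proof (rule integral_dominated_convergence[where w = "\<lambda>t. cmod (f t)"])
      show "AE t in lebesgue. (\<lambda>n. of_real (\<phi> n t) * f t) \<longlonglongrightarrow> indicat_real C t *\<^sub>R f t"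
        unfolding scaleR_conv_of_real by (intro AE_I2 tendsto_intros lim)
      show "AE t in lebesgue. cmod (of_real (\<phi> n t) * f t) \<le> cmod (f t)" for n
        by (auto simp: norm_mult \<phi>_def infdist_nonneg intro!: mult_left_le_one_le)
      show "(\<lambda>t. of_real (\<phi> n t) * f t) \<in> borel_measurable lebesgue" for n
        by (intro borel_measurable_times[OF _ borel_measurable_integrable[OF f]]
            lebesgue_measurable_if_continuous continuous_intros \<phi>c)
      show "(\<lambda>t. indicat_real C t *\<^sub>R f t) \<in> borel_measurable lebesgue"
        using f C by (intro borel_measurable_scaleR borel_measurable_indicator) auto
    qed (use f in auto)
    then show ?thesis
      using cont[OF \<phi>c] by (simp add: LIMSEQ_const_iff)
  qed
qed

section \<open>Cauchy integrals of compactly supported densities\<close>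

text \<open>For \<open>n = 1\<close> this is the Cauchy transform of \<open>f\<close>; for
  \<open>n = 2\<close> it is minus its derivative off the support.\<close>

definition cauchy_integral :: "(real \<Rightarrow> complex) \<Rightarrow> nat \<Rightarrow> complex \<Rightarrow> complex" where
  "cauchy_integral f n z = (LINT t|lebesgue. f t / (z - of_real t) ^ n)"

lemma cauchy_kernel_measurable:
  "(\<lambda>t. 1 / (z - complex_of_real t) ^ n) \<in> borel_measurable lebesgue"
  by (intro measurable_completion) auto

text \<open>The distance condition concerns only points where \<open>f\<close> is nonzero, so the
  estimate serves both off the real axis, with \<open>d\<close> bounded by
  \<open>\<bar>Im z\<bar>\<close>, and at real points off the segment carrying
  \<open>f\<close>.\<close>

lemma cauchy_kernel_integrable:
  assumes f: "integrable lebesgue f" and d: "d > 0"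
    and dist: "\<And>t. f t \<noteq> 0 \<Longrightarrow> d \<le> cmod (z - of_real t)"
  shows "integrable lebesgue (\<lambda>t. f t / (z - of_real t) ^ n)"
    and "cmod (cauchy_integral f n z) \<le> 1 / d ^ n * (LINT t|lebesgue. cmod (f t))"
proof -
  have "cmod (1 / (z - of_real t) ^ n) \<le> 1 / d ^ n" if "f t \<noteq> 0" for t
    using dist[OF that] d by (auto simp: norm_divide norm_power intro!: frac_le power_mono)
  note * = integrable_mult_bounded_on_support[OF f cauchy_kernel_measurable this]
  show "integrable lebesgue (\<lambda>t. f t / (z - of_real t) ^ n)"
    using *(1) by simp
  show "cmod (cauchy_integral f n z) \<le> 1 / d ^ n * (LINT t|lebesgue. cmod (f t))"
    using *(2) by (simp add: cauchy_integral_def)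
qed

lemma abs_Im_le_cmod_diff_of_real: "\<bar>Im z\<bar> \<le> cmod (z - of_real t)"
  using abs_Im_le_cmod[of "z - of_real t"] by simp

lemma cauchy_integral_diff:
  assumes "integrable lebesgue f" "integrable lebesgue g" "Im z \<noteq> 0"
  shows "cauchy_integral (\<lambda>t. f t - g t) n z = cauchy_integral f n z - cauchy_integral g n z"
  using cauchy_kernel_integrable(1)[of _ "\<bar>Im z\<bar>" z n] assms
  by (simp add: cauchy_integral_def diff_divide_distrib abs_Im_le_cmod_diff_of_real)

text \<open>The integration variable is real, so conjugating the kernel merely reflects
  \<open>z\<close> in the real axis.\<close>

lemma cauchy_integral_cnj:
  "cauchy_integral (\<lambda>t. cnj (f t)) n (cnj z) = cnj (cauchy_integral f n z)"
proof -
  have "cnj (f t) / (cnj z - of_real t) ^ n = cnj (f t / (z - of_real t) ^ n)" for t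
    by simp
  then show ?thesis
    by (simp only: cauchy_integral_def Bochner_Integration.integral_cnj)
qed

lemma distance_from_real_segment:
  assumes "z \<notin> complex_of_real ` {a..b}"
  obtains d where "d > 0" "\<And>t. t \<in> {a..b} \<Longrightarrow> d \<le> cmod (z - of_real t)"
proof -
  have "compact (complex_of_real ` {a..b})"
    by (intro compact_continuous_image continuous_intros) auto
  then obtain d where "d > 0" "\<And>w. w \<in> complex_of_real ` {a..b} \<Longrightarrow> d \<le> dist z w"
    using separate_point_closed[of "complex_of_real ` {a..b}" z] assms compact_imp_closed by blast
  then show ?thesis
    using that by (auto simp: dist_norm)
qed

lemma open_off_real_segment: "open (- complex_of_real ` {a..b})"
  by (intro open_Compl compact_imp_closed compact_continuous_image continuous_intros) auto

text \<open>The error of the difference quotient is itself an integral with factor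
  \<open>w - z\<close>, and the remaining kernel is bounded uniformly for \<open>w\<close> near
  \<open>z\<close>.\<close>

lemma cauchy_integral_has_field_derivative:
  assumes f: "integrable lebesgue f" and supp: "\<And>t. t \<notin> {a..b} \<Longrightarrow> f t = 0"
    and z: "z \<notin> complex_of_real ` {a..b}"
  shows "(cauchy_integral f 1 has_field_derivative - cauchy_integral f 2 z) (at z)"
proof -
  let ?N = "LINT t|lebesgue. cmod (f t)"
  obtain d where d: "d > 0" and "\<And>t. t \<in> {a..b} \<Longrightarrow> d \<le> cmod (z - of_real t)"
    using distance_from_real_segment[OF z] by blast
  then have dz: "d \<le> cmod (z - of_real t)" if "f t \<noteq> 0" for t
    using supp that by blast
  have le: "cmod ((cauchy_integral f 1 w - cauchy_integral f 1 z) / (w - z) - (- cauchy_integral f 2 z))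
      \<le> cmod (w - z) / (d / 2 * d\<^sup>2) * ?N" if w: "w \<noteq> z" "dist w z < d / 2" for w
  proof -
    have dw: "d / 2 \<le> cmod (w - of_real t)" if "f t \<noteq> 0" for t
    proof -
      have "cmod (z - of_real t) \<le> cmod (z - w) + cmod (w - of_real t)"
        by (metis add.commute diff_add_cancel diff_diff_eq2 norm_triangle_ineq)
      then show ?thesis
        using dz[OF that] w(2) by (simp add: dist_norm norm_minus_commute)
    qed
    \<comment> \<open>With \<open>p = w - t\<close> and \<open>q = z - t\<close>, so that
      \<open>w - z = p - q\<close>, this is the identity
      \<open>(1/p - 1/q) / (p - q) + 1/q^2 = (p - q) / (p * q^2)\<close>.\<close>
    let ?g = "\<lambda>t. (w - z) * (1 / (w - of_real t) ^ 1 * (1 / (z - of_real t) ^ 2))"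
    have g: "?g t * f t = (f t / (w - of_real t) ^ 1 - f t / (z - of_real t) ^ 1) / (w - z)
        + f t / (z - of_real t) ^ 2" for t
    proof (cases "f t = 0")
      case False
      then have "w - of_real t \<noteq> 0" "z - of_real t \<noteq> 0" "w - z \<noteq> 0"
        using dw[OF False] dz[OF False] d w(1) by auto
      then show ?thesis
        by (simp add: divide_simps power2_eq_square) (simp add: algebra_simps)
    qed simp
    have "(cauchy_integral f 1 w - cauchy_integral f 1 z) / (w - z) - (- cauchy_integral f 2 z)
        = (LINT t|lebesgue. ?g t * f t)"
    proof -
      have "integrable lebesgue (\<lambda>t. f t / (w - of_real t) ^ 1)"
        using d by (intro cauchy_kernel_integrable(1)[OF f _ dw]) auto
      moreover have "integrable lebesgue (\<lambda>t. f t / (z - of_real t) ^ 1)"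
        "integrable lebesgue (\<lambda>t. f t / (z - of_real t) ^ 2)"
        by (rule cauchy_kernel_integrable(1)[OF f d dz]; assumption)+
      ultimately show ?thesis
        unfolding cauchy_integral_def g by simp
    qed
    also have "cmod \<dots> \<le> cmod (w - z) / (d / 2 * d\<^sup>2) * ?N"
    proof (rule integrable_mult_bounded_on_support(2)[OF f])
      show "?g \<in> borel_measurable lebesgue"
        by (intro borel_measurable_times cauchy_kernel_measurable) auto
      show "cmod (?g t) \<le> cmod (w - z) / (d / 2 * d\<^sup>2)" if "f t \<noteq> 0" for t
      proof -
        have le: "d / 2 * d\<^sup>2 \<le> cmod (w - of_real t) * (cmod (z - of_real t))\<^sup>2"
          using dw[OF that] dz[OF that] d by (intro mult_mono power_mono) auto
        have "cmod (?g t) = cmod (w - z) / (cmod (w - of_real t) * (cmod (z - of_real t))\<^sup>2)"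
          by (simp add: norm_mult norm_divide norm_power)
        also have "\<dots> \<le> cmod (w - z) / (d / 2 * d\<^sup>2)"
          using le d by (intro frac_le) auto
        finally show ?thesis .
      qed
    qed
    finally show ?thesis .
  qed
  have "(\<lambda>w. (cauchy_integral f 1 w - cauchy_integral f 1 z) / (w - z) - (- cauchy_integral f 2 z))
      \<midarrow>z\<rightarrow> 0"
  proof (rule Lim_null_comparison)
    show "\<forall>\<^sub>F w in at z. cmod ((cauchy_integral f 1 w - cauchy_integral f 1 z) / (w - z)
        - (- cauchy_integral f 2 z)) \<le> cmod (w - z) / (d / 2 * d\<^sup>2) * ?N"
      unfolding eventually_at using d le by (intro exI[of _ "d / 2"]) auto
    have "((\<lambda>w. cmod (w - z) / (d / 2 * d\<^sup>2) * ?N) \<longlongrightarrow> cmod (z - z) / (d / 2 * d\<^sup>2) * ?N) (at z)"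
      using d by (intro tendsto_intros) auto
    then show "((\<lambda>w. cmod (w - z) / (d / 2 * d\<^sup>2) * ?N) \<longlongrightarrow> 0) (at z)"
      by simp
  qed
  then show ?thesis
    unfolding has_field_derivative_iff by (rule LIM_zero_cancel)
qed

text \<open>Derivatives of holomorphic functions are holomorphic, so the explicit estimate for
  exponent 1 suffices.\<close>

lemma cauchy_integral_2_holomorphic:
  assumes f: "integrable lebesgue f" and supp: "\<And>t. t \<notin> {a..b} \<Longrightarrow> f t = 0"
  shows "cauchy_integral f 2 holomorphic_on - complex_of_real ` {a..b}"
proof -
  note D = cauchy_integral_has_field_derivative[OF f supp]
  have "cauchy_integral f 1 holomorphic_on - complex_of_real ` {a..b}"
    using D unfolding holomorphic_on_open[OF open_off_real_segment] by blast
  then have "(\<lambda>z. - deriv (cauchy_integral f 1) z) holomorphic_on - complex_of_real ` {a..b}"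
    by (intro holomorphic_on_minus holomorphic_deriv open_off_real_segment)
  then show ?thesis
    by (rule holomorphic_transform) (use D DERIV_imp_deriv in fastforce)
qed

section \<open>Vanishing of the Cauchy integral and of the moments\<close>

lemma cauchy_integral_upper_half_plane_zero:
  assumes f: "integrable lebesgue f" and supp: "\<And>t. t \<notin> {a..b} \<Longrightarrow> f t = 0"
    and K: "open K" "K \<noteq> {}" and h: "h > 0"
    and zero: "\<And>x. x \<in> K \<Longrightarrow> Im (cauchy_integral f 2 (Complex x h)) = 0"
    and w: "Im w > 0"
  shows "cauchy_integral f 2 w = 0"
proof -
  let ?A = "{z. 0 < Im z}" and ?B = "{z. Im z < 2 * h}"
  let ?g = "\<lambda>t. cnj (f t)"
  let ?N = "LINT t|lebesgue. cmod (f t)"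
  define F where "F = cauchy_integral f 2"
  \<comment> \<open>\<open>G\<close> is the reflection of \<open>F\<close> in the line
    \<open>Im z = h\<close>, namely \<open>G z = cnj (F (cnj z + 2ih))\<close>; its singularities
    lie on \<open>Im z = 2h\<close>.\<close>
  define G where "G z = cauchy_integral ?g 2 (z - 2 * of_real h * \<i>)" for z
  have g: "integrable lebesgue ?g" "\<And>t. t \<notin> {a..b} \<Longrightarrow> ?g t = 0"
    using f supp by auto
  have F: "F holomorphic_on ?A"
    unfolding F_def by (rule holomorphic_on_subset[OF cauchy_integral_2_holomorphic[OF f supp]]) auto
  have "(cauchy_integral ?g 2 \<circ> (\<lambda>z. z - 2 * of_real h * \<i>)) holomorphic_on ?B"
    by (intro holomorphic_on_compose_gen[OF _ cauchy_integral_2_holomorphic[OF g]] holomorphic_intros)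
      (auto simp: complex_eq_iff)
  moreover have "cauchy_integral ?g 2 \<circ> (\<lambda>z. z - 2 * of_real h * \<i>) = G"
    by (auto simp: G_def)
  ultimately have G: "G holomorphic_on ?B"
    by simp
  have oA: "open ?A" and oB: "open ?B"
    by (simp_all add: open_halfspace_Im_gt open_halfspace_Im_lt)
  have FG: "F z = G z" if "z \<in> ?A" "z \<in> ?B" for z
  proof -
    obtain x0 where x0: "x0 \<in> K"
      using K by blast
    have "F z - G z = 0"
    proof (rule analytic_continuation[where f = "\<lambda>z. F z - G z"])
      show "(\<lambda>z. F z - G z) holomorphic_on ?A \<inter> ?B"
        by (intro holomorphic_intros holomorphic_on_subset[OF F] holomorphic_on_subset[OF G]) auto
      show "open (?A \<inter> ?B)" "connected (?A \<inter> ?B)"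
        using oA oB by (auto intro!: convex_connected convex_Int convex_halfspace_Im_gt convex_halfspace_Im_lt)
      show "(\<lambda>x. Complex x h) ` K \<subseteq> ?A \<inter> ?B" "Complex x0 h \<in> ?A \<inter> ?B" "z \<in> ?A \<inter> ?B"
        using h that by auto
      \<comment> \<open>The identity theorem needs only an accumulation point of zeros; a point of
        the open set \<open>K\<close>, lifted to height \<open>h\<close>, provides one.\<close>
      show "Complex x0 h islimpt (\<lambda>x. Complex x h) ` K"
        unfolding islimpt_approachable
      proof (intro allI impI)
        fix e :: real assume "e > 0"
        have "x0 islimpt K"
          using K(1) x0 by (simp add: interior_limit_point interior_open)
        then obtain x where "x \<in> K" "x \<noteq> x0" "dist x x0 < e"
          using \<open>e > 0\<close> by (auto simp: islimpt_approachable)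
        moreover have "dist (Complex x h) (Complex x0 h) = dist x x0"
          by (simp add: dist_norm cmod_def)
        ultimately show "\<exists>w\<in>(\<lambda>x. Complex x h) ` K. w \<noteq> Complex x0 h \<and> dist w (Complex x0 h) < e"
          by auto
      qed
      show "F u - G u = 0" if u: "u \<in> (\<lambda>x. Complex x h) ` K" for u
      proof -
        obtain x where x: "x \<in> K" "u = Complex x h"
          using u by blast
        have "u - 2 * of_real h * \<i> = cnj u"
          by (simp add: x complex_eq_iff)
        then have "G u = cnj (F u)"
          by (simp add: G_def F_def cauchy_integral_cnj)
        moreover have "cnj (F u) = F u"
          using zero[OF x(1)] by (simp add: F_def x complex_eq_iff)
        ultimately show ?thesis by simp
      qed
    qed
    then show ?thesis by simp
  qed
  define E where "E z = (if z \<in> ?A then F z else G z)" for z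
  have "E holomorphic_on ?A \<union> ?B"
    unfolding E_def using F G oA oB FG by (rule holomorphic_on_If_Un)
  moreover have "?A \<union> ?B = UNIV"
    using h by auto
  ultimately have hol: "E holomorphic_on UNIV"
    by simp
  have Fle: "cmod (F z) \<le> 1 / (Im z)\<^sup>2 * ?N" if "Im z > 0" for z
    unfolding F_def using that abs_Im_le_cmod_diff_of_real[of z]
    by (intro cauchy_kernel_integrable(2)[OF f]) auto
  have Gle: "cmod (G z) \<le> 1 / h\<^sup>2 * ?N" if "Im z \<le> h" for z
  proof -
    have "h \<le> cmod (z - 2 * of_real h * \<i> - of_real t)" for t
      using abs_Im_le_cmod_diff_of_real[of "z - 2 * of_real h * \<i>" t] that h by simp
    then show ?thesis
      unfolding G_def using cauchy_kernel_integrable(2)[OF g(1) h] by simp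
  qed
  \<comment> \<open>Splitting at \<open>Im z = h\<close> keeps each piece at distance at least
    \<open>h\<close> from its singular line: \<open>G\<close> is used below, \<open>F\<close>
    above.\<close>
  have Ele: "cmod (E z) \<le> 1 / h\<^sup>2 * ?N" for z
  proof (cases "Im z \<le> h")
    case True
    then show ?thesis
      using Gle[OF True] FG[of z] h by (auto simp: E_def)
  next
    case False
    then have "cmod (E z) \<le> 1 / (Im z)\<^sup>2 * ?N"
      using Fle[of z] h by (auto simp: E_def)
    also have "\<dots> \<le> 1 / h\<^sup>2 * ?N"
      using False h by (intro mult_right_mono divide_left_mono power_mono) auto
    finally show ?thesis .
  qed
  then have "bounded (range E)"
    by (auto simp: bounded_iff)
  then obtain c where c: "E z = c" for z
    using Liouville_theorem[OF hol] by (auto simp: constant_on_def)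
  \<comment> \<open>The decay of \<open>F\<close> along the imaginary axis forces the Liouville
    constant to be 0.\<close>
  have "((\<lambda>y. 1 / y\<^sup>2 * ?N) \<longlongrightarrow> 0) at_top"
    by (intro tendsto_mult_left_zero) real_asymp
  moreover have "\<forall>\<^sub>F y in at_top. cmod c \<le> 1 / y\<^sup>2 * ?N"
    using eventually_gt_at_top[of 0]
  proof eventually_elim
    case (elim y)
    then show ?case
      using Fle[of "Complex 0 y"] c[of "Complex 0 y"] by (simp add: E_def)
  qed
  ultimately have "cmod c \<le> 0"
    by (intro tendsto_lowerbound) auto
  then show ?thesis
    using c[of w] w by (simp add: E_def F_def)
qed

text \<open>The complement of a bounded convex set in the plane is connected, so the zero set
  spreads from the upper half-plane. This covers a full neighbourhood of infinity, as the moment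
  expansion requires.\<close>

lemma cauchy_integral_off_segment_zero:
  assumes f: "integrable lebesgue f" and supp: "\<And>t. t \<notin> {a..b} \<Longrightarrow> f t = 0"
    and zero: "\<And>w. Im w > 0 \<Longrightarrow> cauchy_integral f 2 w = 0"
    and z: "z \<notin> complex_of_real ` {a..b}"
  shows "cauchy_integral f 2 z = 0"
proof (rule analytic_continuation_open[where f = "cauchy_integral f 2" and g = "\<lambda>_. 0" and s = "{w. Im w > 0}" and s' = "- complex_of_real ` {a..b}"])
  show "open {w. Im w > 0}"
    by (simp add: open_halfspace_Im_gt)
  have "Im \<i> > 0"
    by simp
  then show "{w. Im w > 0} \<noteq> {}"
    by blast
  have "bounded (complex_of_real ` {a..b})" "convex (complex_of_real ` {a..b})"
    by (auto intro!: compact_imp_bounded compact_continuous_image continuous_intros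
        convex_linear_image bounded_linear.linear bounded_linear_of_real)
  then show "connected (- complex_of_real ` {a..b})"
    by (intro connected_complement_bounded_convex) auto
  show "cauchy_integral f 2 holomorphic_on - complex_of_real ` {a..b}"
    by (rule cauchy_integral_2_holomorphic[OF f supp])
qed (use zero z open_off_real_segment in auto)

text \<open>For small \<open>s \<noteq> 0\<close>, the value at \<open>1/s\<close> divided by
  \<open>s^2\<close> is the integral of \<open>f t / (1 - s t)^2\<close>, which expands into a power
  series in \<open>s\<close> whose coefficients are \<open>n + 1\<close> times the moments. A power
  series vanishing near 0 has zero coefficients.\<close>

lemma moments_zero_if_cauchy_integral_zero:
  assumes f: "integrable lebesgue f" and supp: "\<And>t. t \<notin> {a..b} \<Longrightarrow> f t = 0"
    and zero: "\<And>z. z \<notin> complex_of_real ` {a..b} \<Longrightarrow> cauchy_integral f 2 z = 0"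
  shows "(LINT t|lebesgue. of_real t ^ n * f t) = 0"
proof -
  define R where "R = \<bar>a\<bar> + \<bar>b\<bar> + 1"
  have R: "R > 0"
    by (simp add: R_def)
  have tR: "cmod (of_real t) \<le> R" if "f t \<noteq> 0" for t
  proof -
    have "t \<in> {a..b}"
      using supp that by blast
    then show ?thesis
      by (auto simp: R_def)
  qed
  let ?N = "LINT t|lebesgue. cmod (f t)"
  let ?a = "\<lambda>n. of_nat (Suc n) * (LINT t|lebesgue. of_real t ^ n * f t)"
  have m: "(\<lambda>t. complex_of_real t ^ n) \<in> borel_measurable lebesgue" for n
    by (intro lebesgue_measurable_if_continuous continuous_intros)
  have tn: "cmod (of_real t ^ n) \<le> R ^ n" if "f t \<noteq> 0" for t n
    using tR[OF that] R by (auto simp: norm_power intro!: power_mono)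
  note moment = integrable_mult_bounded_on_support[OF f m tn]
  have sums: "(\<lambda>n. ?a n * s ^ n) sums 0" if s: "s \<noteq> 0" "cmod s < 1 / R" for s
  proof -
    have sR: "cmod s * R < 1"
      using s(2) R by (simp add: field_simps)
    let ?u = "\<lambda>n t. of_nat (Suc n) * s ^ n * (of_real t ^ n * f t)"
    have geo: "(\<lambda>n. ?u n t) sums (f t / (1 - s * of_real t)\<^sup>2)"
      and geo_norm: "summable (\<lambda>n. cmod (?u n t))" for t
    proof -
      have st: "cmod (s * of_real t) < 1" if "f t \<noteq> 0"
      proof -
        have "cmod (s * of_real t) \<le> cmod s * R"
          using tR[OF that] by (auto simp: norm_mult intro!: mult_left_mono)
        with sR show ?thesis by simp
      qed
      show "(\<lambda>n. ?u n t) sums (f t / (1 - s * of_real t)\<^sup>2)"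
      proof (cases "f t = 0")
        case False
        show ?thesis
          using sums_mult[OF geometric_deriv_sums[OF st[OF False]], of "f t"]
          by (simp add: power_mult_distrib mult_ac del: of_nat_Suc)
      qed simp
      show "summable (\<lambda>n. cmod (?u n t))"
      proof (cases "f t = 0")
        case False
        have "norm (cmod (s * of_real t)) < 1"
          using st[OF False] by simp
        then have "summable (\<lambda>n. cmod (f t) * (of_nat (Suc n) * cmod (s * of_real t) ^ n))"
          by (intro summable_mult sums_summable[OF geometric_deriv_sums])
        then show ?thesis
          by (simp add: norm_mult norm_power power_mult_distrib mult_ac del: of_nat_Suc)
      qed simp
    qed
    have int: "integrable lebesgue (?u n)" for n
      using moment(1) by simp
    \<comment> \<open>Termwise integration is justified by the convergent majorant with terms
      \<open>?N * (n + 1) * (cmod s * R)^n\<close>.\<close>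
    have "(\<lambda>n. LINT t|lebesgue. ?u n t) sums (LINT t|lebesgue. (\<Sum>n. ?u n t))"
    proof (rule sums_integral[OF int])
      show "AE t in lebesgue. summable (\<lambda>n. cmod (?u n t))"
        using geo_norm by simp
      show "summable (\<lambda>n. LINT t|lebesgue. cmod (?u n t))"
      proof (rule summable_comparison_test')
        have "norm (cmod s * R) < 1"
          using sR R by simp
        then show "summable (\<lambda>n. ?N * (of_nat (Suc n) * (cmod s * R) ^ n))"
          by (intro summable_mult sums_summable[OF geometric_deriv_sums])
        show "norm (LINT t|lebesgue. cmod (?u n t)) \<le> ?N * (of_nat (Suc n) * (cmod s * R) ^ n)"
          if "n \<ge> 0" for n
        proof -
          have "(LINT t|lebesgue. cmod (?u n t))
              \<le> (LINT t|lebesgue. of_nat (Suc n) * cmod s ^ n * (R ^ n * cmod (f t)))"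
          proof (rule integral_mono)
            show "cmod (?u n t) \<le> of_nat (Suc n) * cmod s ^ n * (R ^ n * cmod (f t))" for t
              using tn[of t n] by (cases "f t = 0")
                (auto simp: norm_mult norm_power simp del: of_nat_Suc intro!: mult_left_mono mult_right_mono)
          qed (use int f in auto)
          also have "\<dots> = ?N * (of_nat (Suc n) * (cmod s * R) ^ n)"
            by (simp add: power_mult_distrib)
          finally show ?thesis by simp
        qed
      qed
    qed
    moreover have "(LINT t|lebesgue. (\<Sum>n. ?u n t)) = 0"
    proof -
      \<comment> \<open>Since \<open>cmod s * R < 1\<close>, the point \<open>1/s\<close> lies
        outside the disc of radius \<open>R\<close>, which contains the segment.\<close>
      have "inverse s \<notin> complex_of_real ` {a..b}"
      proof
        assume "inverse s \<in> complex_of_real ` {a..b}"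
        then have "cmod (inverse s) \<le> R"
          by (auto simp: R_def)
        then show False
          using s(1) sR by (simp add: norm_divide inverse_eq_divide divide_le_eq mult.commute)
      qed
      then have "cauchy_integral f 2 (inverse s) = 0"
        by (rule zero)
      have "(\<Sum>n. ?u n t) = f t / (inverse s - of_real t)\<^sup>2 / s\<^sup>2" for t
      proof -
        have "(\<Sum>n. ?u n t) = f t / (1 - s * of_real t)\<^sup>2"
          using geo by (rule sums_unique[symmetric])
        also have "1 - s * of_real t = s * (inverse s - of_real t)"
          using s by (simp add: algebra_simps)
        finally show ?thesis
          by (simp add: power_mult_distrib mult.commute)
      qed
      then have "(LINT t|lebesgue. (\<Sum>n. ?u n t)) = cauchy_integral f 2 (inverse s) / s\<^sup>2"
        by (simp only: cauchy_integral_def integral_divide_zero)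
      then show ?thesis
        using \<open>cauchy_integral f 2 (inverse s) = 0\<close> by simp
    qed
    moreover have "(LINT t|lebesgue. ?u n t) = ?a n * s ^ n" for n
      by (subst integral_mult_right_zero) (simp only: mult_ac)
    ultimately show ?thesis
      by (simp only:)
  qed
  \<comment> \<open>The sum is known only for \<open>s \<noteq> 0\<close>, so the constant
    coefficient comes from the limit at 0. It supplies the value at the centre and leaves indices
    \<open>n > 0\<close>, the case covered by the isolation of zeros in
    \<open>powser_0_nonzero\<close>.\<close>
  have a0: "?a 0 = 0"
  proof -
    have "((\<lambda>_. 0) \<longlongrightarrow> ?a 0) (at (0::complex))"
      using R sums by (intro powser_limit_0_strong[of "1 / R"]) auto
    then show ?thesis
      by (simp add: tendsto_const_iff)
  qed
  have "?a n = 0"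
  proof (rule ccontr)
    assume n: "?a n \<noteq> 0"
    then have "n > 0"
      using a0 by (cases n) auto
    have "(\<lambda>n. ?a n * (s - 0) ^ n) sums (\<lambda>_. 0) s" if "cmod (s - 0) < 1 / R" for s
      using sums[of s] that a0 by (cases "s = 0") (auto simp del: of_nat_Suc)
    then obtain e where e: "e > 0" "\<And>z. z \<in> cball 0 e - {0 :: complex} \<Longrightarrow> (\<lambda>_. 0) z \<noteq> (0 :: complex)"
      using powser_0_nonzero[of "1 / R" 0 ?a "\<lambda>_. 0" n] R n \<open>n > 0\<close> by auto
    have "complex_of_real e \<in> cball 0 e - {0}"
      using e(1) by simp
    from e(2)[OF this] show False by simp
  qed
  then show ?thesis by (simp del: of_nat_Suc)
qed

section \<open>The operator in terms of Cauchy integrals\<close>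

definition planar_density :: "real set \<Rightarrow> (real \<Rightarrow> real \<times> real) \<Rightarrow> real \<Rightarrow> complex" where
  "planar_density S m t = (if t \<in> S then Complex (fst (m t)) (snd (m t)) else 0)"

text \<open>A set of finite measure has \<open>L^2\<close> inside \<open>L^1\<close>; the Cauchy
  integral estimates use integrability only.\<close>

lemma planar_density_integrable:
  assumes S: "S \<in> lmeasurable" and m: "m \<in> L2_fun S"
  shows "integrable lebesgue (planar_density S m)"
proof -
  interpret finite_measure "lebesgue_on S"
    using S by (auto intro!: finite_measureI simp: emeasure_restrict_space fmeasurable_def)
  have meas: "m \<in> borel_measurable (lebesgue_on S)"
    and sq: "integrable (lebesgue_on S) (\<lambda>x. (norm (m x))\<^sup>2)"
    using m by (auto simp: L2_fun_def)
  have "continuous_on UNIV (\<lambda>p :: real \<times> real. Complex (fst p) (snd p))"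
    by (intro continuous_intros)
  then have "(\<lambda>p. Complex (fst p) (snd p)) \<in> borel_measurable (borel :: (real \<times> real) measure)"
    by (rule borel_measurable_continuous_onI)
  with meas have cm: "(\<lambda>t. Complex (fst (m t)) (snd (m t))) \<in> borel_measurable (lebesgue_on S)"
    by (rule measurable_compose)
  have "integrable (lebesgue_on S) (\<lambda>t. Complex (fst (m t)) (snd (m t)))"
  proof (rule Bochner_Integration.integrable_bound[OF _ cm])
    show "integrable (lebesgue_on S) (\<lambda>t. 1 + (norm (m t))\<^sup>2)"
      using sq by simp
    have "cmod (Complex (fst (m t)) (snd (m t))) \<le> norm (1 + (norm (m t))\<^sup>2)" for t
    proof -
      have "cmod (Complex (fst (m t)) (snd (m t))) = norm (m t)"
        by (simp add: complex_norm norm_prod_def)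
      \<comment> \<open>Expanding the square gives
        \<open>norm (m t) \<le> (norm (m t))^2 + 1/4\<close>.\<close>
      moreover have "0 \<le> (norm (m t) - 1 / 2)\<^sup>2"
        by simp
      ultimately show ?thesis
        by (simp add: power2_eq_square algebra_simps)
    qed
    then show "AE t in lebesgue_on S. cmod (Complex (fst (m t)) (snd (m t))) \<le> norm (1 + (norm (m t))\<^sup>2)"
      by simp
  qed
  then have "integrable lebesgue (\<lambda>t. indicat_real S t *\<^sub>R Complex (fst (m t)) (snd (m t)))"
    using S by (subst (asm) integrable_restrict_space) (auto simp: fmeasurable_def)
  also have "(\<lambda>t. indicat_real S t *\<^sub>R Complex (fst (m t)) (snd (m t))) = planar_density S m"
    by (auto simp: planar_density_def)
  finally show ?thesis .
qed

text \<open>With \<open>z = x + iy\<close>, the kernel \<open>1 / (z - t)\<close> equals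
  \<open>pi * (Q - i P)\<close> taken at \<open>x - t\<close>, so its product with
  \<open>m1 + i m2\<close> has real part \<open>pi * (Q m1 + P m2)\<close>.\<close>

lemma conv_kernels_eq_cauchy_integral:
  assumes f: "integrable lebesgue (planar_density S m)" and y: "y > 0"
  shows "conv (conj_poisson_kernel y) (zero_ext S (\<lambda>t. fst (m t))) x
       + conv (poisson_kernel y) (zero_ext S (\<lambda>t. snd (m t))) x
       = Re (cauchy_integral (planar_density S m) 1 (Complex x y)) / pi"
proof -
  let ?f = "planar_density S m"
  let ?z = "Complex x y"
  have "integrable lebesgue (\<lambda>t. complex_of_real (Re (?f t)))" "integrable lebesgue (\<lambda>t. complex_of_real (Im (?f t)))"
    using f by auto
  then have int: "integrable lebesgue (\<lambda>t. complex_of_real (Re (?f t)) / (?z - of_real t) ^ 1)"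
      "integrable lebesgue (\<lambda>t. complex_of_real (Im (?f t)) / (?z - of_real t) ^ 1)"
    using y abs_Im_le_cmod_diff_of_real[of ?z]
    by (auto intro: cauchy_kernel_integrable(1)[where n = 1 and d = y, simplified])
  have Q: "conj_poisson_kernel y (x - t) * zero_ext S (\<lambda>t. fst (m t)) t
      = Re (complex_of_real (Re (?f t)) / (?z - of_real t) ^ 1) / pi" for t
    by (simp add: conj_poisson_kernel_def zero_ext_def planar_density_def Re_divide mult_ac)
  have P: "poisson_kernel y (x - t) * zero_ext S (\<lambda>t. snd (m t)) t
      = - Im (complex_of_real (Im (?f t)) / (?z - of_real t) ^ 1) / pi" for t
    by (simp add: poisson_kernel_def zero_ext_def planar_density_def Im_divide mult_ac)
  have split: "?f t / c = complex_of_real (Re (?f t)) / c + \<i> * (complex_of_real (Im (?f t)) / c)" for t c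
    by (subst complex_eq[of "?f t"]) (simp add: add_divide_distrib)
  have "cauchy_integral ?f 1 ?z = (LINT t|lebesgue. complex_of_real (Re (?f t)) / (?z - of_real t) ^ 1
      + \<i> * (complex_of_real (Im (?f t)) / (?z - of_real t) ^ 1))"
    unfolding cauchy_integral_def by (rule Bochner_Integration.integral_cong[OF refl split])
  also have "\<dots> = (LINT t|lebesgue. complex_of_real (Re (?f t)) / (?z - of_real t) ^ 1)
      + \<i> * (LINT t|lebesgue. complex_of_real (Im (?f t)) / (?z - of_real t) ^ 1)"
    using Bochner_Integration.integral_add[OF int(1) integrable_mult_right[OF int(2), of \<i>]]
    by (simp only: integral_mult_right_zero)
  finally have "Re (cauchy_integral ?f 1 ?z)
      = (LINT t|lebesgue. Re (complex_of_real (Re (?f t)) / (?z - of_real t) ^ 1))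
      - (LINT t|lebesgue. Im (complex_of_real (Im (?f t)) / (?z - of_real t) ^ 1))"
    by (simp only: integral_Re[OF int(1)] integral_Im[OF int(2)] plus_complex.sel Re_i_times)
  then show ?thesis
    unfolding conv_def Q P by (simp add: diff_divide_distrib)
qed

text \<open>For holomorphic \<open>C\<close>, the \<open>y\<close>-derivative of
  \<open>Re C(x + iy)\<close> is \<open>Re (i C') = - Im C'\<close>; here \<open>C'\<close> is minus
  the integral with exponent 2.\<close>

lemma b2_fun_eq_cauchy_integral:
  assumes f: "integrable lebesgue (planar_density S m)" and S: "S \<subseteq> {a..b}" and h: "h > 0"
  shows "b2_fun S h m x = - Im (cauchy_integral (planar_density S m) 2 (Complex x h)) / pi"
proof -
  let ?f = "planar_density S m"
  let ?C = "cauchy_integral ?f"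
  have "(?C 1 has_field_derivative - ?C 2 (Complex x h)) (at (Complex x h))"
    using S h by (intro cauchy_integral_has_field_derivative[OF f, of a b])
      (auto simp: planar_density_def complex_eq_iff)
  moreover have "((\<lambda>y. Complex x y) has_vector_derivative \<i>) (at h)"
  proof -
    have "((\<lambda>y. of_real x + of_real y * \<i>) has_vector_derivative \<i>) (at h)"
      by (auto intro!: derivative_eq_intros)
    then show ?thesis
      by (simp add: Complex_eq mult.commute)
  qed
  ultimately have "((\<lambda>y. ?C 1 (Complex x y)) has_vector_derivative \<i> * - ?C 2 (Complex x h)) (at h)"
    using field_vector_diff_chain_at[of "Complex x" \<i> h "?C 1" "- ?C 2 (Complex x h)"]
    by (simp only: o_def)
  then have "((\<lambda>y. Re (?C 1 (Complex x y))) has_vector_derivative Re (\<i> * - ?C 2 (Complex x h))) (at h)"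
    by (rule bounded_linear.has_vector_derivative[OF bounded_linear_Re])
  then have "((\<lambda>y. Re (?C 1 (Complex x y))) has_field_derivative Im (?C 2 (Complex x h))) (at h)"
    by (simp add: has_real_derivative_iff_has_vector_derivative)
  then have "((\<lambda>y. Re (?C 1 (Complex x y)) / pi) has_field_derivative Im (?C 2 (Complex x h)) / pi) (at h)"
    by (rule DERIV_cdivide)
  \<comment> \<open>The kernel identity is available only for \<open>y > 0\<close>, so it is
    transferred to the derivative at \<open>h\<close> through a neighbourhood of
    \<open>h\<close>.\<close>
  moreover have "\<forall>\<^sub>F y in nhds h. y > 0"
    using h eventually_nhds_in_open[of "{0<..}" h] by simp
  then have "\<forall>\<^sub>F y in nhds h. conv (conj_poisson_kernel y) (zero_ext S (\<lambda>t. fst (m t))) x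
       + conv (poisson_kernel y) (zero_ext S (\<lambda>t. snd (m t))) x = Re (?C 1 (Complex x y)) / pi"
    by eventually_elim (rule conv_kernels_eq_cauchy_integral[OF f])
  ultimately have "((\<lambda>y. conv (conj_poisson_kernel y) (zero_ext S (\<lambda>t. fst (m t))) x
       + conv (poisson_kernel y) (zero_ext S (\<lambda>t. snd (m t))) x)
       has_field_derivative Im (?C 2 (Complex x h)) / pi) (at h)"
    by (subst DERIV_cong_ev[OF refl _ refl])
  then show ?thesis
    unfolding b2_fun_def by (simp add: DERIV_imp_deriv)
qed

section \<open>Regularity of the image functions\<close>

text \<open>Continuity serves twice: it places the image in \<open>L2_fun K\<close>, and it turns
  equality almost everywhere on \<open>K\<close> into equality at every point of
  \<open>K\<close>.\<close>

lemma b2_fun_continuous: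
  assumes f: "integrable lebesgue (planar_density S m)" and S: "S \<subseteq> {a..b}" and h: "h > 0"
  shows "continuous_on UNIV (b2_fun S h m)"
proof -
  let ?F = "cauchy_integral (planar_density S m) 2"
  have "?F holomorphic_on - complex_of_real ` {a..b}"
    using S by (intro cauchy_integral_2_holomorphic[OF f]) (auto simp: planar_density_def)
  then have "continuous_on (- complex_of_real ` {a..b}) ?F"
    by (rule holomorphic_on_imp_continuous_on)
  then have "continuous_on UNIV (\<lambda>x. ?F (Complex x h))"
  proof (rule continuous_on_compose2)
    show "continuous_on UNIV (\<lambda>x. Complex x h)"
      by (intro continuous_intros)
    show "range (\<lambda>x. Complex x h) \<subseteq> - complex_of_real ` {a..b}"
      using h by (auto simp: complex_eq_iff)
  qed
  then have "continuous_on UNIV (\<lambda>x. - Im (?F (Complex x h)) / pi)"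
    by (intro continuous_on_divide continuous_on_minus continuous_on_Im continuous_on_const) auto
  moreover have "b2_fun S h m = (\<lambda>x. - Im (?F (Complex x h)) / pi)"
    by (intro ext b2_fun_eq_cauchy_integral[OF f S h])
  ultimately show ?thesis
    by simp
qed

text \<open>Continuity on the whole line gives a bound on the compact closure of \<open>K\<close>,
  and \<open>K\<close> has finite measure.\<close>

lemma continuous_in_L2_fun:
  fixes g :: "real \<Rightarrow> real"
  assumes g: "continuous_on UNIV g" and K: "K \<in> sets lebesgue" "bounded K"
  shows "g \<in> L2_fun K"
proof -
  have meas: "g \<in> borel_measurable (lebesgue_on K)"
    using g K(1) by (meson continuous_imp_measurable_on_sets_lebesgue continuous_on_subset subset_UNIV)
  have KL: "K \<in> lmeasurable"
    using K bounded_set_imp_lmeasurable by blast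
  interpret finite_measure "lebesgue_on K"
    using KL by (auto intro!: finite_measureI simp: emeasure_restrict_space fmeasurable_def)
  have "compact (g ` closure K)"
    using g K(2) by (intro compact_continuous_image) (auto intro: continuous_on_subset)
  then obtain B where B: "\<And>x. x \<in> closure K \<Longrightarrow> norm (g x) \<le> B"
    by (meson bounded_iff compact_imp_bounded imageI)
  have "integrable (lebesgue_on K) (\<lambda>x. (norm (g x))\<^sup>2)"
  proof (rule integrable_const_bound)
    show "AE x in lebesgue_on K. norm ((norm (g x))\<^sup>2) \<le> B\<^sup>2"
    proof (rule AE_I2)
      fix x assume "x \<in> space (lebesgue_on K)"
      then have "x \<in> closure K"
        using closure_subset by (auto simp: space_restrict_space)
      then show "norm ((norm (g x))\<^sup>2) \<le> B\<^sup>2"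
        using power_mono[OF B, of x 2] by simp
    qed
  qed (use meas in measurable)
  then show ?thesis
    using meas by (simp add: L2_fun_def)
qed

text \<open>The part of \<open>K\<close> where \<open>g\<close> is nonzero is open and negligible,
  hence empty.\<close>

lemma open_AE_zero_imp_zero:
  fixes g :: "real \<Rightarrow> real"
  assumes g: "continuous_on UNIV g" and K: "open K"
    and zero: "AE x in lebesgue_on K. g x = 0" and x: "x \<in> K"
  shows "g x = 0"
proof (rule ccontr)
  assume "g x \<noteq> 0"
  let ?U = "K \<inter> {y. g y \<noteq> 0}"
  have "open {y. g y \<noteq> 0}"
    using open_Collect_neq[OF g continuous_on_const] .
  then have U: "open ?U" "?U \<noteq> {}"
    using K x \<open>g x \<noteq> 0\<close> by auto
  have "AE y in lebesgue. y \<notin> ?U"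
    using zero K by (auto simp: AE_restrict_space_iff)
  moreover have "?U \<in> sets lebesgue"
    using U(1) by (simp add: lmeasurable_open borel_open)
  ultimately have "negligible ?U"
    by (simp only: negligible_iff_null_sets AE_iff_null_sets)
  with U show False
    using open_not_negligible by blast
qed

section \<open>Injectivity on representatives and passage to classes\<close>

text \<open>The vanishing results are applied to the difference of the two densities. Linearity is
  read off the Cauchy integrals, not the \<open>deriv\<close> expression.\<close>

lemma b2_fun_AE_eq_imp_ae_eq:
  assumes S: "S \<in> lmeasurable" "S \<subseteq> {a..b}" and K: "open K" "K \<noteq> {}" and h: "h > 0"
    and m: "m \<in> L2_fun S" "m' \<in> L2_fun S"
    and eq: "AE x in lebesgue_on K. b2_fun S h m x = b2_fun S h m' x"
  shows "(m, m') \<in> ae_eq S"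
proof -
  let ?f = "planar_density S m" and ?f' = "planar_density S m'"
  let ?g = "\<lambda>t. ?f t - ?f' t"
  note f = planar_density_integrable[OF S(1) m(1)] and f' = planar_density_integrable[OF S(1) m(2)]
  have g: "integrable lebesgue ?g"
    using f f' by simp
  have supp: "?g t = 0" if "t \<notin> {a..b}" for t
    using that S(2) by (auto simp: planar_density_def)
  have "b2_fun S h m x - b2_fun S h m' x = 0" if "x \<in> K" for x
  proof (rule open_AE_zero_imp_zero[OF _ K(1) _ that])
    show "continuous_on UNIV (\<lambda>x. b2_fun S h m x - b2_fun S h m' x)"
      using b2_fun_continuous[OF f S(2) h] b2_fun_continuous[OF f' S(2) h]
      by (intro continuous_intros)
    show "AE x in lebesgue_on K. b2_fun S h m x - b2_fun S h m' x = 0"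
      using eq by simp
  qed
  then have "Im (cauchy_integral ?g 2 (Complex x h)) = 0" if "x \<in> K" for x
    using that h by (simp add: cauchy_integral_diff[OF f f'] b2_fun_eq_cauchy_integral[OF f S(2) h]
        b2_fun_eq_cauchy_integral[OF f' S(2) h])
  note upper = cauchy_integral_upper_half_plane_zero[OF g supp K h this]
  note off = cauchy_integral_off_segment_zero[OF g supp upper]
  have "AE t in lebesgue. ?g t = 0"
    using moments_zero_if_cauchy_integral_zero[OF g supp off]
    by (intro AE_zero_if_moments_zero[OF g supp])
  then have "AE t in lebesgue. t \<in> S \<longrightarrow> m t = m' t"
  proof eventually_elim
    case (elim t)
    show ?case
    proof
      assume "t \<in> S"
      then have "Complex (fst (m t)) (snd (m t)) = Complex (fst (m' t)) (snd (m' t))"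
        using elim by (simp add: planar_density_def)
      then show "m t = m' t"
        by (simp add: prod_eq_iff)
    qed
  qed
  then show ?thesis
    using m S(1) by (simp add: ae_eq_def AE_restrict_space_iff fmeasurableD)
qed

text \<open>Changing \<open>m\<close> on a null set does not affect the integrals, so the values
  agree at every point. This makes the union defining \<open>b2\<close> collapse to a single
  class.\<close>

lemma b2_fun_cong_ae_eq:
  assumes S: "S \<in> lmeasurable" "S \<subseteq> {a..b}" and h: "h > 0" and eq: "(m, m') \<in> ae_eq S"
  shows "b2_fun S h m = b2_fun S h m'"
proof
  fix x
  let ?f = "planar_density S m" and ?f' = "planar_density S m'"
  have m: "m \<in> L2_fun S" "m' \<in> L2_fun S" and "AE t in lebesgue_on S. m t = m' t"
    using eq by (auto simp: ae_eq_def)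
  then have ae: "AE t in lebesgue. t \<in> S \<longrightarrow> m t = m' t"
    using S(1) by (simp add: AE_restrict_space_iff fmeasurableD)
  note f = planar_density_integrable[OF S(1) m(1)] and f' = planar_density_integrable[OF S(1) m(2)]
  have d: "h \<le> cmod (Complex x h - of_real t)" for t
    using abs_Im_le_cmod_diff_of_real[of "Complex x h" t] by simp
  have "cauchy_integral ?f 2 (Complex x h) = cauchy_integral ?f' 2 (Complex x h)"
    unfolding cauchy_integral_def
  proof (rule integral_cong_AE)
    show "AE t in lebesgue. ?f t / (Complex x h - of_real t) ^ 2 = ?f' t / (Complex x h - of_real t) ^ 2"
      using ae by eventually_elim (auto simp: planar_density_def)
  qed (intro borel_measurable_integrable cauchy_kernel_integrable(1)[OF _ h d] f f')+
  then show "b2_fun S h m x = b2_fun S h m' x"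
    by (simp only: b2_fun_eq_cauchy_integral[OF f S(2) h] b2_fun_eq_cauchy_integral[OF f' S(2) h])
qed

lemma b2_class:
  assumes S: "S \<in> lmeasurable" "S \<subseteq> {a..b}" and h: "h > 0" and m: "m \<in> L2_fun S"
  shows "b2 S K h (ae_eq S `` {m}) = ae_eq K `` {b2_fun S h m}"
  unfolding b2_def
proof (rule UN_constant_eq)
  show "m \<in> ae_eq S `` {m}"
    using equiv_ae_eq m by (rule equiv_class_self)
  show "\<forall>m' \<in> ae_eq S `` {m}. ae_eq K `` {b2_fun S h m'} = ae_eq K `` {b2_fun S h m}"
    using b2_fun_cong_ae_eq[OF S h, of m] by auto
qed

theorem proposition2:
  fixes S K :: "real set" and h :: real
  assumes "S \<noteq> {}" "open S" "bounded S" "is_interval S"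
    and "K \<noteq> {}" "open K" "bounded K" "is_interval K"
    and "h > 0"
  shows "b2 S K h \<in> L2 S \<rightarrow> L2 K \<and> inj_on (b2 S K h) (L2 S)"
proof -
  have S: "S \<in> lmeasurable"
    using assms by (simp add: bounded_set_imp_lmeasurable)
  obtain a where "S \<subseteq> cbox (- a) a"
    using bounded_subset_cbox_symmetric[OF \<open>bounded S\<close>] .
  then have ab: "S \<subseteq> {- a..a}"
    by simp
  have L2K: "b2_fun S h m \<in> L2_fun K" if "m \<in> L2_fun S" for m
    using assms b2_fun_continuous[OF planar_density_integrable[OF S that] ab \<open>h > 0\<close>]
    by (intro continuous_in_L2_fun) auto
  have "b2 S K h M \<in> L2 K" if "M \<in> L2 S" for M
  proof -
    obtain m where m: "m \<in> L2_fun S" "M = ae_eq S `` {m}"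
      using \<open>M \<in> L2 S\<close> unfolding L2_def by (rule quotientE)
    then show ?thesis
      using L2K by (simp add: b2_class[OF S ab \<open>h > 0\<close>] L2_def quotientI)
  qed
  moreover have "inj_on (b2 S K h) (L2 S)"
  proof (rule inj_onI)
    fix M M' assume M: "M \<in> L2 S" "M' \<in> L2 S" and eq: "b2 S K h M = b2 S K h M'"
    obtain m where m: "m \<in> L2_fun S" "M = ae_eq S `` {m}"
      using M(1) unfolding L2_def by (rule quotientE)
    obtain m' where m': "m' \<in> L2_fun S" "M' = ae_eq S `` {m'}"
      using M(2) unfolding L2_def by (rule quotientE)
    have "(b2_fun S h m, b2_fun S h m') \<in> ae_eq K"
    \<comment> \<open>Membership in \<open>L2_fun K\<close> is essential here: outside it both
      relational images could be empty, and hence equal without the functions being related.\<close>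
    proof (rule eq_equiv_class[OF _ equiv_ae_eq])
      show "ae_eq K `` {b2_fun S h m} = ae_eq K `` {b2_fun S h m'}"
        using eq m m' by (simp add: b2_class[OF S ab \<open>h > 0\<close>])
    qed (rule L2K[OF m'(1)])
    then have "AE x in lebesgue_on K. b2_fun S h m x = b2_fun S h m' x"
      by (simp add: ae_eq_def)
    then have "(m, m') \<in> ae_eq S"
      using assms m m' by (intro b2_fun_AE_eq_imp_ae_eq[OF S ab]) auto
    then show "M = M'"
      using equiv_class_eq[OF equiv_ae_eq] m m' by blast
  qed
  ultimately show ?thesis by blast
qed

end
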